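(* Let $\mathbb{F}$ be a field and let $P$ be a syntactic multilinear algebraic branching program (smABP) of size $S$ with source $s$ and sink $t$, computing a polynomial $f\in\mathbb{F}[x_1,\ldots,x_n]$. Then there exist sets of edges $\{(u_1,v_1),\ldots,(u_m,v_m)\}$ and $\{(w_1,a_1),\ldots,(w_r,a_r)\}$ of $P$ such that (1) for every $i\in\{1,\ldots,m\}$, $n/3\le |X_{s,u_i}|\le 2n/3$; (2) for every $i\in\{1,\ldots,r\}$, $|X_{s,w_i}|+|X_{a_i,t}|\le 2n/3$; and (3) $f=\sum_{i=1}^m [s,u_i]\cdot \mathrm{label}(u_i,v_i)\cdot[v_i,t]+\sum_{i=1}^r [s,w_i]\cdot\mathrm{label}(w_i,a_i)\cdot[a_i,t]$.
   Context: Let $X=\{x_1,\ldots,x_n\}$. An algebraic branching program (ABP) $P$ over $\mathbb{F}$ is a directed acyclic graph whose vertices are partitioned into layers $L_0,\ldots,L_\ell$, with edges going only from $L_i$ to $L_{i+1}$; $L_0=\{s\}$ ($s$ is the source, the one vertex of in-degree 0) and $L_\ell=\{t\}$ ($t$ is the sink, the one vertex of out-degree 0). Each edge $e$ carries a label $\mathrm{label}(e)\in X\cup\mathbb{F}$. The size of $P$ is its number of nodes. The weight of a path is the product of its edge labels, and the polynomial computed by $P$ is the sum of the weights of all $s$-to-$t$ paths. For nodes $u,v$, $[u,v]$ denotes the polynomial computed by the subprogram of $P$ with source $u$ and sink $v$ (the sum of weights of all $u$-to-$v$ paths; $[u,u]=1$), and $X_{u,v}$ denotes the set of all variables that occur as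 labels on some path from $u$ to $v$ in $P$. $P$ is syntactic multilinear (an smABP) if every variable occurs at most once on every $s$-to-$t$ path. Either of the two edge sets may be empty. *)

theory Defs
  imports "HOL-Library.Poly_Mapping" "HOL-Library.Disjoint_Sets" "Graph_Theory.Graph_Theory"
begin

text \<open>
  Polynomials in the variables \<open>x_0, x_1, \<dots>\<close> as finitely supported maps from exponent vectors
  to coefficients; \<open>Poly_Mapping\<close> supplies the ring structure. The ring in \<open>x_1, \<dots>, x_n\<close>
  is the subring of those that mention only these variables; the locale \<open>abp\<close> below
  restricts edge labels accordingly.
\<close>

type_synonym 'a mpoly = "(nat \<Rightarrow>\<^sub>0 nat) \<Rightarrow>\<^sub>0 'a"

datatype 'a label = Var nat | Const 'a

fun label_poly :: "'a::field label \<Rightarrow> 'a mpoly" where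
  "label_poly (Var i) = Poly_Mapping.single (Poly_Mapping.single i 1) 1"
| "label_poly (Const c) = Poly_Mapping.single 0 c"

record ('v, 'a) abp =
  graph :: "'v pair_pre_digraph"
  lab :: "'v \<times> 'v \<Rightarrow> 'a label"
  depth :: nat
  layer :: "nat \<Rightarrow> 'v set"
  source :: 'v
  sink :: 'v

definition abp_size :: "('v, 'a) abp \<Rightarrow> nat" where
  "abp_size P = card (pverts (graph P))"

definition edges :: "('v, 'a) abp \<Rightarrow> ('v \<times> 'v) set" where
  "edges P = parcs (graph P)"

text \<open>Paths are lists of edges; the empty list is the only path from a vertex to itself.\<close>

definition paths :: "('v, 'a) abp \<Rightarrow> 'v \<Rightarrow> 'v \<Rightarrow> ('v \<times> 'v) list set" where
  "paths P u v = {p. pre_digraph.apath (with_proj (graph P)) u p v}"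

definition weight :: "('v, 'a::field) abp \<Rightarrow> ('v \<times> 'v) list \<Rightarrow> 'a mpoly" where
  "weight P p = (\<Prod>e\<leftarrow>p. label_poly (lab P e))"

text \<open>
  \<open>between P u v\<close> is \<open>[u, v]\<close>. The sum is over a finite set, since \<open>apath\<close> forbids
  repeated vertices (in a layered graph every walk is such a path).
\<close>

definition between :: "('v, 'a::field) abp \<Rightarrow> 'v \<Rightarrow> 'v \<Rightarrow> 'a mpoly" where
  "between P u v = (\<Sum>p\<in>paths P u v. weight P p)"

definition computed :: "('v, 'a::field) abp \<Rightarrow> 'a mpoly" where
  "computed P = between P (source P) (sink P)"

definition path_vars :: "('v, 'a) abp \<Rightarrow> 'v \<Rightarrow> 'v \<Rightarrow> nat set" where
  "path_vars P u v = {i. \<exists>p\<in>paths P u v. \<exists>e\<in>set p. lab P e = Var i}"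

text \<open>
  Acyclicity and nonemptiness of the layers follow from the assumptions below. The requirement
  \<open>0 < depth P\<close> excludes only the one-vertex program, which has no edges and computes \<open>1\<close>.
\<close>

locale abp = pair_fin_digraph "graph P" for n :: nat and P :: "('v, 'a::field) abp" +
  assumes depth_pos: "0 < depth P"
    and layers_cover: "(\<Union>i\<le>depth P. layer P i) = pverts (graph P)"
    and layers_disjoint: "disjoint_family_on (layer P) {..depth P}"
    and edges_layered: "(u, v) \<in> edges P \<Longrightarrow> \<exists>i<depth P. u \<in> layer P i \<and> v \<in> layer P (Suc i)"
    and first_layer: "layer P 0 = {source P}"
    and last_layer: "layer P (depth P) = {sink P}"
    and unique_source: "{v \<in> pverts (graph P). in_degree (with_proj (graph P)) v = 0} = {source P}"
    and unique_sink: "{v \<in> pverts (graph P). out_degree (with_proj (graph P)) v = 0} = {sink P}"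
    and labels: "e \<in> edges P \<Longrightarrow> lab P e \<in> Var ` {1..n} \<union> range Const"

locale smabp = abp +
  assumes multilinear:
    "p \<in> paths P (source P) (sink P) \<Longrightarrow> count_list (map (lab P) p) (Var i) \<le> 1"

end

theory Submission
  imports Defs
begin

text \<open>
  Since \<open>|X_{s,v}|\<close> is monotone along edges, the edges \<open>(u, v)\<close> at which it first
  exceeds \<open>2n/3\<close> (or at which \<open>v = t\<close>) meet every source-to-sink path exactly once, which gives
  the decomposition of \<open>f\<close>. Such an edge is put in the first set if \<open>|X_{s,u}| \<ge> n/3\<close>. Otherwise
  \<open>|X_{v,t}| < n/3\<close>, because multilinearity makes \<open>X_{s,v}\<close> and \<open>X_{v,t}\<close> disjoint, and the edge
  goes in the second set.
\<close>

context abp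
begin

section \<open>Layers and acyclicity\<close>

lemma layer_unique:
  assumes "v \<in> layer P i" "v \<in> layer P j" "i \<le> depth P" "j \<le> depth P"
  shows "i = j"
proof (rule ccontr)
  assume "i \<noteq> j"
  then have "layer P i \<inter> layer P j = {}"
    using layers_disjoint assms(3,4) by (intro disjoint_family_onD) auto
  with assms(1,2) show False by blast
qed

lemma edge_layer_less:
  assumes "(u, v) \<in> edges P" "u \<in> layer P i" "v \<in> layer P j" "i \<le> depth P" "j \<le> depth P"
  shows "i < j"
proof -
  obtain k where k: "k < depth P" "u \<in> layer P k" "v \<in> layer P (Suc k)"
    using edges_layered[OF assms(1)] by blast
  have "k = i" "Suc k = j"
    using k assms by (auto intro: layer_unique)
  then show ?thesis by simp
qed

lemma sink_no_out_edge: "(sink P, v) \<notin> edges P"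
proof
  assume e: "(sink P, v) \<in> edges P"
  then obtain j where j: "j < depth P" "v \<in> layer P (Suc j)"
    using edges_layered by blast
  have "depth P < Suc j"
    using edge_layer_less[OF e _ j(2)] last_layer j(1) by simp
  with j(1) show False by simp
qed

lemma source_neq_sink: "source P \<noteq> sink P"
proof
  assume "source P = sink P"
  then have "0 = depth P"
    using first_layer last_layer by (intro layer_unique[of "source P"]) auto
  then show False using depth_pos by simp
qed

text \<open>Every edge climbs one layer, so a walk never returns to the layer it started in. The
  list is taken with \<open>tl\<close> because the start vertex itself lies in layer
  \<open>i\<close>.\<close>

lemma awalk_verts_later_layer:
  assumes "awalk u p v" "u \<in> layer P i" "i \<le> depth P" "x \<in> set (tl (awalk_verts u p))"
  shows "\<exists>j. i < j \<and> j \<le> depth P \<and> x \<in> layer P j"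
  using assms
proof (induction p arbitrary: u i)
  case Nil
  then show ?case by simp
next
  case (Cons e p)
  have e: "e \<in> edges P" "u = fst e" "awalk (snd e) p v"
    using Cons.prems(1) by (auto simp: awalk_Cons_iff edges_def)
  then obtain k where k: "k < depth P" "u \<in> layer P k" "snd e \<in> layer P (Suc k)"
    using edges_layered[of "fst e" "snd e"] by auto
  have "i < Suc k"
    using edge_layer_less[of "fst e" "snd e" i "Suc k"] e k Cons.prems by simp
  have "x = snd e \<or> x \<in> set (tl (awalk_verts (snd e) p))"
    using Cons.prems(4) e(3) by (cases p) (auto simp: awalk_Cons_iff)
  then show ?case
  proof
    assume "x = snd e"
    then show ?thesis using k \<open>i < Suc k\<close> by (intro exI[of _ "Suc k"]) auto
  next
    assume "x \<in> set (tl (awalk_verts (snd e) p))"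
    from Cons.IH[OF e(3) k(3) _ this] k(1) \<open>i < Suc k\<close> show ?thesis
      by (meson Suc_leI less_trans)
  qed
qed

text \<open>If the first vertex of a walk recurred, it would lie in two different layers.\<close>

lemma awalk_imp_distinct_verts:
  assumes "awalk u p v"
  shows "distinct (awalk_verts u p)"
  using assms
proof (induction p arbitrary: u)
  case Nil
  then show ?case by simp
next
  case (Cons e p)
  have e: "u = fst e" "awalk (snd e) p v" "u \<in> pverts (graph P)"
    using Cons.prems by (auto simp: awalk_Cons_iff)
  obtain i where i: "i \<le> depth P" "u \<in> layer P i"
    using e(3) layers_cover by blast
  have "u \<notin> set (awalk_verts (snd e) p)"
  proof
    assume "u \<in> set (awalk_verts (snd e) p)"
    then obtain j where "i < j" "j \<le> depth P" "u \<in> layer P j"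
      using awalk_verts_later_layer[OF Cons.prems i(2,1)] e(1) by auto
    then show False using i layer_unique by blast
  qed
  then show ?case using Cons.IH[OF e(2)] e(1) by simp
qed

text \<open>This makes the concatenation and splitting rules of \<open>awalk\<close> available for
  \<open>paths\<close>, with no distinctness conditions to check.\<close>

lemma mem_paths_iff: "p \<in> paths P u v \<longleftrightarrow> awalk u p v"
  using awalk_imp_distinct_verts by (auto simp: paths_def apath_def)

section \<open>Paths and the variables on them\<close>

lemma paths_append:
  assumes "p \<in> paths P u v" "q \<in> paths P v w"
  shows "p @ q \<in> paths P u w"
  using assms awalk_appendI by (auto simp: mem_paths_iff)

lemma edge_in_paths: "(u, v) \<in> edges P \<Longrightarrow> [(u, v)] \<in> paths P u v"
  using arc_implies_awalk[of "(u, v)"] by (simp add: mem_paths_iff edges_def)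

lemma paths_subset_edges: "p \<in> paths P u v \<Longrightarrow> set p \<subseteq> edges P"
  by (auto simp: mem_paths_iff edges_def awalk_def)

lemma finite_paths: "finite (paths P u v)"
  unfolding paths_def by (rule apaths_finite)

lemma finite_edges: "finite (edges P)"
  by (simp add: edges_def)

text \<open>Each path to \<open>u\<close> extends along the edge to a path to \<open>v\<close>. With
  \<open>w\<close> the source, this makes a bound on |X_{s,v}| pass to predecessors.\<close>

lemma path_vars_mono_edge:
  assumes "(u, v) \<in> edges P"
  shows "path_vars P w u \<subseteq> path_vars P w v"
proof
  fix i assume "i \<in> path_vars P w u"
  then obtain p e where p: "p \<in> paths P w u" "e \<in> set p" "lab P e = Var i"
    by (auto simp: path_vars_def)
  have "p @ [(u, v)] \<in> paths P w v"
    using paths_append[OF p(1) edge_in_paths[OF assms]] .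
  then show "i \<in> path_vars P w v"
    using p(2,3) unfolding path_vars_def by (intro CollectI bexI[of _ "p @ [(u, v)]"]) auto
qed

lemma path_vars_subset: "path_vars P u v \<subseteq> {1..n}"
proof
  fix i assume "i \<in> path_vars P u v"
  then obtain p e where "p \<in> paths P u v" "e \<in> set p" "lab P e = Var i"
    by (auto simp: path_vars_def)
  moreover from this have "e \<in> edges P" using paths_subset_edges by blast
  ultimately show "i \<in> {1..n}" using labels[of e] by auto
qed

lemma finite_path_vars: "finite (path_vars P u v)"
  using path_vars_subset finite_subset by blast

text \<open>By acyclicity only the empty path joins \<open>u\<close> to itself.\<close>

lemma path_vars_refl: "path_vars P u u = {}"
proof -
  have "p = []" if "awalk u p u" for p
    using awalk_imp_distinct_verts[OF that] that
    by (metis apath_def apath_nonempty_ends)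
  then show ?thesis by (fastforce simp: path_vars_def mem_paths_iff)
qed

section \<open>Decomposition along a cut\<close>

text \<open>
  A set closed under predecessors that separates \<open>s\<close> from \<open>t\<close> is left exactly once by each path.
\<close>

lemma between_eq_sum_cut:
  assumes closed: "\<And>u v. (u, v) \<in> edges P \<Longrightarrow> v \<in> L \<Longrightarrow> u \<in> L"
    and "s \<in> L" "t \<notin> L"
  shows "between P s t =
    (\<Sum>(u, v)\<in>{(u, v) \<in> edges P. u \<in> L \<and> v \<notin> L}.
      between P s u * label_poly (lab P (u, v)) * between P v t)"
proof -
  define C where "C = {(u, v) \<in> edges P. u \<in> L \<and> v \<notin> L}"
  define T where "T = (SIGMA e:C. paths P s (fst e) \<times> paths P (snd e) t)"
  define g :: "('v \<times> 'v) \<times> ('v \<times> 'v) list \<times> ('v \<times> 'v) list \<Rightarrow> ('v \<times> 'v) list"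
    where "g = (\<lambda>(e, p, q). p @ e # q)"
  have finC: "finite C"
    unfolding C_def by (rule finite_subset[OF _ finite_edges]) auto
  \<comment> \<open>Closure under predecessors, propagated backwards from the end of the walk. It
    will apply to the prefix before a cut edge.\<close>
  have stay: "x \<in> L \<and> (\<forall>e\<in>set p. snd e \<in> L)" if "awalk x p u" "u \<in> L" for x p u
    using that
  proof (induction p arbitrary: x)
    case Nil
    then show ?case by (simp add: awalk_Nil_iff)
  next
    case (Cons e p)
    then show ?case
      using closed[of "fst e" "snd e"] by (auto simp: awalk_Cons_iff edges_def)
  qed
  have "inj_on g T"
  proof (rule inj_onI)
    fix a b assume a: "a \<in> T" "b \<in> T" "g a = g b"
    \<comment> \<open>The triple is recovered from the glued path by cutting it at the first edge
      whose head lies outside \<open>L\<close>; hence \<open>g\<close> is injective.\<close>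
    have *: "takeWhile (\<lambda>e. snd e \<in> L) (g c) = fst (snd c) \<and>
        dropWhile (\<lambda>e. snd e \<in> L) (g c) = fst c # snd (snd c)" if "c \<in> T" for c
    proof -
      obtain e p q where c: "c = (e, p, q)" by (cases c)
      have "\<forall>e\<in>set p. snd e \<in> L" "snd e \<notin> L"
        using that stay[of s p "fst e"] by (force simp: c T_def C_def mem_paths_iff)+
      then show ?thesis by (simp add: c g_def takeWhile_append dropWhile_append)
    qed
    show "a = b"
      using *[OF a(1)] *[OF a(2)] a(3) by (simp add: prod_eq_iff)
  qed
  moreover have "g ` T = paths P s t"
  proof
    show "g ` T \<subseteq> paths P s t"
      by (auto simp: T_def C_def g_def mem_paths_iff edges_def awalk_append_iff awalk_Cons_iff)
  next
    \<comment> \<open>The induction finds the first edge that leaves \<open>L\<close>; one exists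
      because \<open>t\<close> is outside.\<close>
    have "\<exists>e p' q. p = p' @ e # q \<and> fst e \<in> L \<and> snd e \<notin> L" if "awalk x p t" "x \<in> L" for x p
      using that
    proof (induction p arbitrary: x)
      case Nil
      then show ?case using \<open>t \<notin> L\<close> by (simp add: awalk_Nil_iff)
    next
      case (Cons e p)
      then have e: "x = fst e" "awalk (snd e) p t" by (auto simp: awalk_Cons_iff)
      show ?case
      proof (cases "snd e \<in> L")
        case True
        then show ?thesis using Cons.IH[OF e(2)] by (metis append_Cons)
      next
        case False
        then show ?thesis using e Cons.prems(2) by (metis append_Nil)
      qed
    qed
    note split = this
    show "paths P s t \<subseteq> g ` T"
    proof
      fix p assume p: "p \<in> paths P s t"
      then obtain e p' q where e: "p = p' @ e # q" "fst e \<in> L" "snd e \<notin> L"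
        using split[of s p] \<open>s \<in> L\<close> by (auto simp: mem_paths_iff)
      have "(e, p', q) \<in> T"
        using p e by (auto simp: T_def C_def mem_paths_iff edges_def awalk_append_iff awalk_Cons_iff)
      then show "p \<in> g ` T" using e(1) by (force simp: g_def)
    qed
  qed
  ultimately have "between P s t = (\<Sum>c\<in>T. weight P (g c))"
    unfolding between_def by (simp add: sum.reindex_cong)
  also have "\<dots> = (\<Sum>e\<in>C. \<Sum>(p, q)\<in>paths P s (fst e) \<times> paths P (snd e) t. weight P (p @ e # q))"
    unfolding T_def g_def
    by (subst sum.Sigma) (auto simp: finC finite_paths case_prod_unfold)
  \<comment> \<open>Weights multiply under concatenation. The instance of
    \<open>sum_distrib_right\<close> moves only the edge label into the left sum, so that a product
    of two sums remains for \<open>sum_product\<close>.\<close>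
  also have "\<dots> = (\<Sum>e\<in>C. between P s (fst e) * label_poly (lab P e) * between P (snd e) t)"
    unfolding between_def sum_distrib_right[where r = "label_poly x" for x] sum_product
      sum.cartesian_product
    by (simp add: weight_def mult.assoc)
  finally show ?thesis
    by (simp add: C_def case_prod_unfold)
qed

end

section \<open>Consequences of multilinearity\<close>

text \<open>Joining a path to \<open>v\<close> and a path from \<open>v\<close> that share a
  variable gives a source-to-sink path on which it occurs twice.\<close>

lemma (in smabp) path_vars_disjoint:
  "path_vars P (source P) v \<inter> path_vars P v (sink P) = {}"
proof (rule ccontr)
  assume "path_vars P (source P) v \<inter> path_vars P v (sink P) \<noteq> {}"
  then obtain i p q d e where
    p: "p \<in> paths P (source P) v" "d \<in> set p" "lab P d = Var i" and
    q: "q \<in> paths P v (sink P)" "e \<in> set q" "lab P e = Var i"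
    by (auto simp: path_vars_def)
  have "Var i \<in> set (map (lab P) p)" "Var i \<in> set (map (lab P) q)"
    using p(2,3) q(2,3) by force+
  then have "count_list (map (lab P) p) (Var i) > 0" "count_list (map (lab P) q) (Var i) > 0"
    by (metis count_list_0_iff not_gr0)+
  moreover have "count_list (map (lab P) (p @ q)) (Var i) \<le> 1"
    using multilinear[OF paths_append[OF p(1) q(1)]] .
  ultimately show False by simp
qed

lemma (in smabp) card_path_vars_add_le:
  "card (path_vars P (source P) v) + card (path_vars P v (sink P)) \<le> n"
proof -
  have "card (path_vars P (source P) v \<union> path_vars P v (sink P)) \<le> card {1..n}"
    using path_vars_subset by (intro card_mono) auto
  then show ?thesis
    by (simp add: card_Un_disjoint finite_path_vars path_vars_disjoint)
qed

theorem theorem1: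
  fixes P :: "('v, 'a::field) abp" and f :: "'a mpoly" and n S :: nat
  assumes "smabp n P"
    and "abp_size P = S"
    and "computed P = f"
  shows "\<exists>A B. A \<subseteq> edges P \<and> B \<subseteq> edges P \<and>
    (\<forall>(u, v)\<in>A. real n / 3 \<le> real (card (path_vars P (source P) u)) \<and>
                real (card (path_vars P (source P) u)) \<le> 2 * real n / 3) \<and>
    (\<forall>(w, a)\<in>B. real (card (path_vars P (source P) w)) + real (card (path_vars P a (sink P)))
                \<le> 2 * real n / 3) \<and>
    f = (\<Sum>(u, v)\<in>A. between P (source P) u * label_poly (lab P (u, v)) * between P v (sink P)) +
        (\<Sum>(w, a)\<in>B. between P (source P) w * label_poly (lab P (w, a)) * between P a (sink P))"
proof -
  interpret smabp n P by fact
  let ?h = "\<lambda>v. real (card (path_vars P (source P) v))"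
  \<comment> \<open>Excluding the sink keeps \<open>L\<close> a cut even when |X_{s,t}| \<le>
    2n/3.\<close>
  define L where "L = {v. ?h v \<le> 2 * real n / 3 \<and> v \<noteq> sink P}"
  define C where "C = {(u, v) \<in> edges P. u \<in> L \<and> v \<notin> L}"
  \<comment> \<open>Only the lower bound needs to be imposed: the upper one holds since
    \<open>u\<close> is in \<open>L\<close>.\<close>
  define A where "A = {(u, v) \<in> C. real n / 3 \<le> ?h u}"
  define B where "B = C - A"
  have sub: "C \<subseteq> edges P" "A \<subseteq> C" "B \<subseteq> C"
    by (auto simp: C_def A_def B_def)
  have closed: "u \<in> L" if "(u, v) \<in> edges P" "v \<in> L" for u v
  proof -
    have "?h u \<le> ?h v"
      using path_vars_mono_edge[OF that(1)] by (simp add: card_mono finite_path_vars)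
    moreover have "u \<noteq> sink P" using that(1) sink_no_out_edge by blast
    ultimately show ?thesis using that(2) by (simp add: L_def)
  qed
  have "f = (\<Sum>(u, v)\<in>C. between P (source P) u * label_poly (lab P (u, v)) * between P v (sink P))"
    unfolding C_def assms(3)[symmetric] computed_def
    by (rule between_eq_sum_cut[OF closed]) (auto simp: L_def path_vars_refl source_neq_sink)
  also have "\<dots> = (\<Sum>(u, v)\<in>A. between P (source P) u * label_poly (lab P (u, v)) * between P v (sink P))
      + (\<Sum>(u, v)\<in>B. between P (source P) u * label_poly (lab P (u, v)) * between P v (sink P))"
    unfolding B_def
    by (subst add.commute) (rule sum.subset_diff[OF sub(2) finite_subset[OF sub(1) finite_edges]])
  finally have f: "f = \<dots>" .
  have B: "?h w + real (card (path_vars P a (sink P))) \<le> 2 * real n / 3" if "(w, a) \<in> B" for w a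
  proof -
    have w: "?h w < real n / 3" "a \<notin> L"
      using that by (auto simp: A_def B_def C_def)
    show ?thesis
    \<comment> \<open>The two ways to be outside \<open>L\<close>. At the sink, X_{a,t} is empty and
      |X_{s,w}| < n/3 suffices.\<close>
    proof (cases "a = sink P")
      case True
      then show ?thesis using w(1) by (simp add: path_vars_refl)
    next
      case False
      \<comment> \<open>Here |X_{a,t}| \<le> n - |X_{s,a}| < n/3, and |X_{s,w}| < n/3 as
        well.\<close>
      then have "?h a > 2 * real n / 3" using w(2) by (simp add: L_def)
      moreover have "?h a + real (card (path_vars P a (sink P))) \<le> real n"
        using card_path_vars_add_le[of a] by linarith
      ultimately show ?thesis using w(1) by linarith
    qed
  qed
  have A: "real n / 3 \<le> ?h u \<and> ?h u \<le> 2 * real n / 3" if "(u, v) \<in> A" for u v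
    using that by (auto simp: A_def C_def L_def)
  show ?thesis
  proof (intro exI conjI)
    show "A \<subseteq> edges P" "B \<subseteq> edges P" using sub by blast+
  qed (use A B f in auto)
qed

end
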